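(* Let $p\in\mathbb{N}$, $m\in\mathbb{N}^*$, $a>0$, and $h\in\mathcal{D}^q\cap\mathcal{K}^q$ for some integer $q\ge p$. For $c>0$ define the function $h_c\colon\mathbb{R}_+\to\mathbb{R}$ by $h_c(x)=h(cx)$ for $x>0$. If $\Delta h_a$ lies in $\mathcal{D}^p\cap\mathcal{K}^p_+\cap\mathcal{K}^q$ (resp. $\mathcal{D}^p\cap\mathcal{K}^p_-\cap\mathcal{K}^q$), then there is a unique solution $f\colon\mathbb{R}_+\to\mathbb{R}$ lying in $\mathcal{K}^p$ to the equation $$\sum_{j=0}^{m-1}f(x+a\,j)=h(x),\qquad x>0,$$ namely $$f(x)=\Sigma h_{am}\left(\frac{x+a}{am}\right)-\Sigma h_{am}\left(\frac{x}{am}\right).$$ Moreover, this solution lies in $\mathcal{K}^p_-$ (resp. $\mathcal{K}^p_+$).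
   Context: $\mathbb{N}=\{0,1,2,\ldots\}$, $\mathbb{N}^*=\{1,2,\ldots\}$, $\mathbb{R}_+=(0,\infty)$, $\Delta f(x)=f(x+1)-f(x)$. For an integer $p\ge -1$, a function $f\colon I\to\mathbb{R}$ on a real interval $I$ is $p$-convex (resp. $p$-concave) if for all $x_0<\cdots<x_{p+1}$ in $I$ the divided difference $f[x_0,\ldots,x_{p+1}]$ is $\ge 0$ (resp. $\le 0$), where $f[x_0,\ldots,x_n]=\sum_{k=0}^n f(x_k)/\prod_{j\ne k}(x_k-x_j)$. $\mathcal{K}^p_+$ (resp. $\mathcal{K}^p_-$) is the set of functions $\mathbb{R}_+\to\mathbb{R}$ that are $p$-convex (resp. $p$-concave) on some $[a,\infty)$, and $\mathcal{K}^p=\mathcal{K}^p_+\cup\mathcal{K}^p_-$. $\mathcal{D}^p$ is the set of $g\colon\mathbb{R}_+\to\mathbb{R}$ with $\Delta^pg(n)\to 0$ as $n\to\infty$ over the integers (for $g\in\mathcal{K}^p$ this is equivalent to $\Delta^pg(x)\to0$ as $x\to\infty$ over the reals). For $g\in\mathcal{D}^p\cap\mathcal{K}^p$, the function $\Sigma g\colon\mathbb{R}_+\to\mathbb{R}$ is $$\Sigma g(x)=\lim_{n\to\infty}\Big(-g(x)+\sum_{k=1}^{n-1}(g(k)-g(x+k))+\sum_{j=1}^p\binom{x}{j}\Delta^{j-1}g(n)\Big);$$ the limit exists, does not depend on the choice of such $p$, and $\Sigma g$ is the unique solution $f\in\mathcal{K}^p$ of $\Delta f=g$ with $f(1)=0$.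 $\Sigma h_{am}(y)$ denotes the value at $y$ of the function obtained by applying $\Sigma$ to $h_{am}$ (which lies in $\mathcal{D}^q\cap\mathcal{K}^q$). *)

theory Defs
  imports Complex_Main
begin

text \<open>
  A function on \<open>\<real>\<^sub>+ = (0, \<infinity>)\<close> is represented by a total function of type \<open>real \<Rightarrow> real\<close>;
  its values at nonpositive arguments are irrelevant for every notion below.
\<close>

definition fwd_diff :: "(real \<Rightarrow> real) \<Rightarrow> real \<Rightarrow> real" where
  "fwd_diff f x = f (x + 1) - f x"

definition divided_diff :: "(real \<Rightarrow> real) \<Rightarrow> (nat \<Rightarrow> real) \<Rightarrow> nat \<Rightarrow> real" where
  "divided_diff f x n = (\<Sum>k\<le>n. f (x k) / (\<Prod>j\<in>{..n} - {k}. x k - x j))"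

text \<open>
  The order \<open>p\<close> is an integer with \<open>p \<ge> -1\<close>, so that \<open>nat (p + 1)\<close> is just \<open>p + 1\<close>.
\<close>

definition p_convex_on :: "int \<Rightarrow> real set \<Rightarrow> (real \<Rightarrow> real) \<Rightarrow> bool" where
  "p_convex_on p I f \<longleftrightarrow>
     (\<forall>x. strict_mono_on {..nat (p + 1)} x \<longrightarrow> x ` {..nat (p + 1)} \<subseteq> I \<longrightarrow>
        divided_diff f x (nat (p + 1)) \<ge> 0)"

definition p_concave_on :: "int \<Rightarrow> real set \<Rightarrow> (real \<Rightarrow> real) \<Rightarrow> bool" where
  "p_concave_on p I f \<longleftrightarrow>
     (\<forall>x. strict_mono_on {..nat (p + 1)} x \<longrightarrow> x ` {..nat (p + 1)} \<subseteq> I \<longrightarrow>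
        divided_diff f x (nat (p + 1)) \<le> 0)"

definition K_plus :: "int \<Rightarrow> (real \<Rightarrow> real) set" where
  "K_plus p = {f. \<exists>a>0. p_convex_on p {a..} f}"

definition K_minus :: "int \<Rightarrow> (real \<Rightarrow> real) set" where
  "K_minus p = {f. \<exists>a>0. p_concave_on p {a..} f}"

definition K_class :: "int \<Rightarrow> (real \<Rightarrow> real) set" where
  "K_class p = K_plus p \<union> K_minus p"

definition D_class :: "nat \<Rightarrow> (real \<Rightarrow> real) set" where
  "D_class p = {g. (\<lambda>n::nat. (fwd_diff ^^ p) g (real n)) \<longlonglongrightarrow> 0}"

definition Sigma_seq :: "nat \<Rightarrow> (real \<Rightarrow> real) \<Rightarrow> real \<Rightarrow> nat \<Rightarrow> real" where
  "Sigma_seq p g x n =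
     - g x + (\<Sum>k = 1..<n. g (real k) - g (x + real k))
       + (\<Sum>j = 1..p. (x gchoose j) * (fwd_diff ^^ (j - 1)) g (real n))"

text \<open>
  The limit is the same for every admissible order \<open>p\<close>, so \<open>p\<close> is not an argument.
  The definition is meaningful only for \<open>x > 0\<close> and \<open>g\<close> in \<open>D_class p \<inter> K_class p\<close> for some \<open>p\<close>.
\<close>

definition Sigma_op :: "(real \<Rightarrow> real) \<Rightarrow> real \<Rightarrow> real" where
  "Sigma_op g x =
     (THE L. \<exists>p. g \<in> D_class p \<inter> K_class (int p) \<and> Sigma_seq p g x \<longlonglongrightarrow> L)"

definition dilate :: "(real \<Rightarrow> real) \<Rightarrow> real \<Rightarrow> real \<Rightarrow> real" where
  "dilate h c x = h (c * x)"

end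

theory Submission
  imports Defs
begin

text \<open>
  Write \<open>c = a m\<close>, \<open>h\<^sub>c (x) = h (c x)\<close> and \<open>H = \<Sigma> h\<^sub>c\<close>.  Since \<open>H (x + 1) - H x = h (c x)\<close>, the sum
  \<open>\<Sum>j<m. F (x + a j)\<close> telescopes to \<open>H (x/c + 1) - H (x/c) = h x\<close>, so \<open>F\<close> solves the equation.
  What is left is that \<open>F\<close> is eventually concave of order \<open>p\<close> (convex in the second case), although \<open>H\<close> is only known to be
  concave or convex of the possibly larger order \<open>q\<close>, and that \<open>F\<close> is the only solution in this class.

  Both follow from one uniqueness principle (\<open>newton_null_unique\<close>).  Let the Newton remainder of
  order \<open>P\<close> of \<open>f\<close> be the error at \<open>n + x\<close> of the polynomial that interpolates \<open>f\<close> at \<open>n, \<dots>, n + P - 1\<close>.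
  If two functions have the same difference \<open>\<Delta>\<close> and both have remainders that vanish as
  \<open>n \<rightarrow> \<infinity>\<close>, then they differ by a constant: their difference \<open>d\<close> has period one, so that its
  remainder is \<open>d x - d 1\<close>.  If \<open>f\<close> solves the equation, then \<open>\<phi> (x) = f (c x)\<close> satisfies
  \<open>\<Delta>\<phi> (x) = h (c x + a) - h (c x) = \<Delta>h\<^sub>a (m x)\<close>, and call the right-hand side \<open>g\<^sub>m\<close>.  For \<open>f = F\<close> the
  remainders of order \<open>q + 1\<close> vanish because \<open>\<phi> (x) = H (x + 1/m) - H x\<close>; for \<open>\<Sigma> g\<^sub>m\<close>, and for any
  solution of class \<open>p\<close>, those of order \<open>p + 1\<close> vanish, hence also those of order \<open>q + 1\<close>.  Thus
  \<open>F (c x)\<close> equals \<open>\<Sigma> g\<^sub>m\<close> plus a constant, which is concave if \<open>g\<^sub>m\<close> is convex and vice versa, and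
  two solutions differ by a constant, which the equation forces to be zero.

  The analytic input is \<open>newton_rem_bound\<close>: if \<open>f\<close> is convex of order \<open>p\<close>, then its divided differences
  with \<open>p + 1\<close> nodes increase when nodes move to the right (\<open>set_dd_mono\<close>), so the remainder
  of order \<open>p + 1\<close> is at most a constant, depending on \<open>x\<close>, times \<open>\<Delta>\<^sup>p f (n + N) - \<Delta>\<^sup>p f n\<close>.
  When \<open>\<Delta> f\<close> has vanishing \<open>p\<close>-th differences, this tends to zero.  Applied to a function \<open>g\<close>
  with vanishing \<open>p\<close>-th differences, it bounds the increments of the sequence that defines
  \<open>\<Sigma> g\<close> by a telescoping summable sequence, so the limit exists.  Divided differences with \<open>p + 2\<close> nodes
  annihilate the polynomial part of that sequence and leave those of \<open>- (\<Sum>k<n. g (x + k))\<close>, which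
  explains the change of sign between \<open>g\<close> and \<open>\<Sigma> g\<close>.
\<close>

section \<open>Divided differences over finite sets\<close>

text \<open>
  A divided difference does not depend on the order of its nodes.  Indexing it by the set of nodes
  builds this symmetry in and makes replacing one node by another an operation on sets.
\<close>

definition set_dd :: "(real \<Rightarrow> real) \<Rightarrow> real set \<Rightarrow> real" where
  "set_dd f S = (\<Sum>x\<in>S. f x / (\<Prod>y\<in>S - {x}. x - y))"

lemma set_dd_cong: "(\<And>x. x \<in> S \<Longrightarrow> f x = g x) \<Longrightarrow> set_dd f S = set_dd g S"
  by (simp add: set_dd_def)

lemma set_dd_add: "set_dd (\<lambda>x. f x + g x) S = set_dd f S + set_dd g S"
  by (simp add: set_dd_def add_divide_distrib sum.distrib)

lemma set_dd_diff: "set_dd (\<lambda>x. f x - g x) S = set_dd f S - set_dd g S"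
  by (simp add: set_dd_def diff_divide_distrib sum_subtractf)

lemma set_dd_cmult: "set_dd (\<lambda>x. c * f x) S = c * set_dd f S"
  by (simp add: set_dd_def sum_distrib_left)

lemma set_dd_uminus: "set_dd (\<lambda>x. - f x) S = - set_dd f S"
  using set_dd_cmult[of "-1"] by simp

lemma set_dd_sum: "set_dd (\<lambda>x. \<Sum>i\<in>A. f i x) S = (\<Sum>i\<in>A. set_dd (f i) S)"
  unfolding set_dd_def by (subst sum.swap) (simp add: sum_divide_distrib)

lemma set_dd_tendsto:
  assumes "\<And>x. x \<in> S \<Longrightarrow> (\<lambda>n. u n x) \<longlonglongrightarrow> f x"
  shows "(\<lambda>n. set_dd (u n) S) \<longlonglongrightarrow> set_dd f S"
  unfolding set_dd_def divide_inverse by (intro tendsto_intros assms)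

lemma set_dd_affine:
  assumes "c > 0" "finite S"
  shows "set_dd (\<lambda>x. f (c * x + d)) S = c ^ (card S - 1) * set_dd f ((\<lambda>x. c * x + d) ` S)"
proof -
  define T where "T = (\<lambda>x. c * x + d)"
  have inj: "inj T" using assms by (auto simp: T_def inj_on_def)
  have "set_dd f (T ` S) = (\<Sum>x\<in>S. f (T x) / (\<Prod>y\<in>T ` S - {T x}. T x - y))"
    unfolding set_dd_def using inj by (subst sum.reindex) (auto intro: inj_on_subset)
  also have "\<dots> = (\<Sum>x\<in>S. f (T x) / (c ^ (card S - 1) * (\<Prod>y\<in>S - {x}. x - y)))"
  proof (rule sum.cong[OF refl])
    fix x assume x: "x \<in> S"
    have "T ` S - {T x} = T ` (S - {x})"
      using inj by (auto simp: inj_def)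
    hence "(\<Prod>y\<in>T ` S - {T x}. T x - y) = (\<Prod>y\<in>S - {x}. T x - T y)"
      using inj by (simp add: prod.reindex[OF inj_on_subset])
    also have "\<dots> = (\<Prod>y\<in>S - {x}. c * (x - y))"
      by (simp add: T_def algebra_simps)
    also have "\<dots> = c ^ (card S - 1) * (\<Prod>y\<in>S - {x}. x - y)"
      using x assms by (simp add: prod.distrib)
    finally show "f (T x) / (\<Prod>y\<in>T ` S - {T x}. T x - y) =
        f (T x) / (c ^ (card S - 1) * (\<Prod>y\<in>S - {x}. x - y))" by simp
  qed
  finally show ?thesis
    using assms by (simp add: set_dd_def T_def sum_distrib_left)
qed

lemma set_dd_insert:
  assumes "finite S" "a \<notin> S"
  shows "set_dd f (insert a S) = f a / (\<Prod>y\<in>S. a - y) + set_dd (\<lambda>x. f x / (x - a)) S"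
proof -
  have "(\<Prod>y\<in>insert a S - {x}. x - y) = (x - a) * (\<Prod>y\<in>S - {x}. x - y)" if "x \<in> S" for x
  proof -
    have "insert a S - {x} = insert a (S - {x})" using that assms by auto
    thus ?thesis using assms by simp
  qed
  moreover have "insert a S - {a} = S" using assms by auto
  ultimately show ?thesis
    using assms by (simp add: set_dd_def)
qed

text \<open>
  This is the recurrence of divided differences, read as the effect of moving one node from \<open>b\<close>
  to \<open>a\<close>.  It turns the sign of a divided difference into monotonicity of the
  divided differences with one node less.
\<close>

lemma set_dd_exchange:
  assumes "finite S" "a \<notin> S" "b \<notin> S" "a \<noteq> b"
  shows "set_dd f (insert a S) - set_dd f (insert b S) = (a - b) * set_dd f (insert a (insert b S))"
proof -
  have *: "(a - b) * set_dd (\<lambda>x. f x / (x - a) / (x - b)) S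
      = set_dd (\<lambda>x. f x / (x - a)) S - set_dd (\<lambda>x. f x / (x - b)) S"
    unfolding set_dd_cmult[symmetric] set_dd_diff[symmetric]
  proof (rule set_dd_cong)
    fix x assume "x \<in> S"
    hence "x - a \<noteq> 0" "x - b \<noteq> 0" using assms by auto
    thus "(a - b) * (f x / (x - a) / (x - b)) = f x / (x - a) - f x / (x - b)"
      by (simp add: field_simps)
  qed
  have "set_dd f (insert a (insert b S)) = f a / ((a - b) * (\<Prod>y\<in>S. a - y))
      + ((f b / (b - a)) / (\<Prod>y\<in>S. b - y) + set_dd (\<lambda>x. f x / (x - a) / (x - b)) S)"
    using assms by (simp add: set_dd_insert)
  moreover have "(a - b) * (f a / ((a - b) * (\<Prod>y\<in>S. a - y))) = f a / (\<Prod>y\<in>S. a - y)"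
    using assms by simp
  moreover have "(a - b) * ((f b / (b - a)) / (\<Prod>y\<in>S. b - y)) = - (f b / (\<Prod>y\<in>S. b - y))"
  proof -
    have "(a - b) * (f b / (b - a)) = - f b" using assms by (simp add: field_simps)
    thus ?thesis by (metis minus_divide_left times_divide_eq_right)
  qed
  ultimately show ?thesis
    using assms * by (simp add: set_dd_insert distrib_left)
qed

lemma set_dd_const:
  assumes "card S \<ge> 2"
  shows "set_dd (\<lambda>_. c) S = 0"
  using assms
proof (induction "card S - 2" arbitrary: S)
  case base: 0
  then obtain a b where "S = {a, b}" "a \<noteq> b" by (metis card_2_iff diff_is_0_eq le_antisym)
  thus ?case using set_dd_exchange[of "{}" a b "\<lambda>_. c"] by (simp add: set_dd_def)
next
  case (Suc k)
  have fin: "finite S" using Suc.hyps(2) card.infinite by fastforce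
  have "card S \<ge> 2" using Suc by auto
  then obtain T where T: "T \<subseteq> S" "card T = 2" by (meson obtain_subset_with_card_n)
  then obtain a b where ab: "T = {a, b}" "a \<noteq> b" by (meson card_2_iff)
  define R where "R = S - {a, b}"
  have S: "S = insert a (insert b R)" "a \<notin> R" "b \<notin> R" "finite R"
    using T ab fin by (auto simp: R_def)
  have "set_dd (\<lambda>_. c) (insert a R) = 0" "set_dd (\<lambda>_. c) (insert b R) = 0"
    using Suc S ab by (auto intro!: Suc.hyps(1))
  with set_dd_exchange[of R a b "\<lambda>_. c"] S ab show ?case by simp
qed

text \<open>
  The Leibniz rule for a linear factor: after \<open>x - c\<close> is split as \<open>(x - a) + (a - c)\<close>, the first
  factor cancels the node \<open>a\<close>.
\<close>

lemma set_dd_times_linear: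
  assumes "finite S" "a \<in> S"
  shows "set_dd (\<lambda>x. (x - c) * f x) S = set_dd f (S - {a}) + (a - c) * set_dd f S"
proof -
  have "set_dd (\<lambda>x. (x - a) * f x) (insert a (S - {a})) = set_dd f (S - {a})"
    using assms by (subst set_dd_insert, simp_all, intro set_dd_cong) auto
  hence "set_dd (\<lambda>x. (x - a) * f x + (a - c) * f x) S = set_dd f (S - {a}) + (a - c) * set_dd f S"
    using assms by (simp add: set_dd_add set_dd_cmult insert_absorb)
  moreover have "(\<lambda>x. (x - a) * f x + (a - c) * f x) = (\<lambda>x. (x - c) * f x)"
    by (auto simp: algebra_simps)
  ultimately show ?thesis by simp
qed

text \<open>
  Divided differences annihilate polynomials of low degree; every linear factor that is
  removed costs at most one node.
\<close>

lemma set_dd_gbinomial: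
  assumes "card S \<ge> j + 2"
  shows "set_dd (\<lambda>x. x gchoose j) S = 0"
  using assms
proof (induction j arbitrary: S)
  case 0
  thus ?case by (simp add: set_dd_const)
next
  case (Suc j)
  have fin: "finite S" using Suc.prems card.infinite by fastforce
  obtain a where a: "a \<in> S" using Suc.prems by fastforce
  have eq: "(\<lambda>x::real. x gchoose Suc j) = (\<lambda>x. (1 / real (Suc j)) * ((x - real j) * (x gchoose j)))"
    using gbinomial_absorption'[of "Suc j"] by (auto simp: gbinomial_prod_rev field_simps)
  show ?case
    unfolding eq set_dd_cmult using fin a Suc
    by (subst set_dd_times_linear[of _ a]) auto
qed

section \<open>Newton interpolation on a grid of step one\<close>

definition grid :: "real \<Rightarrow> nat \<Rightarrow> real set" where
  "grid y k = (\<lambda>i. y + real i) ` {..<k}"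

lemma finite_grid [simp]: "finite (grid y k)"
  by (simp add: grid_def)

lemma card_grid [simp]: "card (grid y k) = k"
  by (simp add: grid_def card_image inj_on_def)

lemma grid_0 [simp]: "grid y 0 = {}"
  by (simp add: grid_def)

lemma grid_Suc: "grid y (Suc k) = insert (y + real k) (grid y k)"
  by (auto simp: grid_def lessThan_Suc)

lemma grid_Suc_left: "grid y (Suc k) = insert y (grid (y + 1) k)"
  unfolding grid_def lessThan_Suc_eq_insert_0 image_insert image_image by (simp add: algebra_simps)

lemma grid_ge: "z \<in> grid y k \<Longrightarrow> y \<le> z"
  by (auto simp: grid_def)

lemma grid_less: "z \<in> grid y k \<Longrightarrow> z < y + real k"
  by (auto simp: grid_def)

lemma set_dd_grid: "set_dd f (grid y (Suc j)) = (fwd_diff ^^ j) f y / fact j"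
proof (induction j arbitrary: y)
  case 0
  show ?case by (simp add: grid_Suc set_dd_def)
next
  case (Suc j)
  have "set_dd f (insert (y + real (Suc j)) (grid (y + 1) j)) - set_dd f (insert y (grid (y + 1) j))
     = (y + real (Suc j) - y) * set_dd f (insert (y + real (Suc j)) (insert y (grid (y + 1) j)))"
    by (intro set_dd_exchange) (auto dest: grid_less grid_ge)
  moreover have "insert (y + real (Suc j)) (grid (y + 1) j) = grid (y + 1) (Suc j)"
    by (simp add: grid_Suc add_ac)
  moreover have "insert (y + real (Suc j)) (insert y (grid (y + 1) j)) = grid y (Suc (Suc j))"
    by (subst grid_Suc, subst grid_Suc_left) (rule refl)
  ultimately have "real (Suc j) * set_dd f (grid y (Suc (Suc j)))
      = (fwd_diff ^^ j) f (y + 1) / fact j - (fwd_diff ^^ j) f y / fact j"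
    by (simp add: grid_Suc_left[symmetric] Suc.IH)
  also have "\<dots> = (fwd_diff ^^ Suc j) f y / fact j"
    by (simp add: fwd_diff_def diff_divide_distrib)
  finally show ?case by (simp add: field_simps del: of_nat_Suc funpow.simps)
qed

lemma fwd_diff_pow_eq_set_dd: "(fwd_diff ^^ j) f y = fact j * set_dd f (grid y (Suc j))"
  by (simp add: set_dd_grid)

definition newton_rem :: "nat \<Rightarrow> (real \<Rightarrow> real) \<Rightarrow> real \<Rightarrow> real \<Rightarrow> real" where
  "newton_rem P f x y = f (y + x) - (\<Sum>j<P. (x gchoose j) * (fwd_diff ^^ j) f y)"

text \<open>
  The classical error formula of Newton interpolation.  The \<open>P\<close>-th Newton term is the exchange
  of the node \<open>y + x\<close> for the next grid point, which gives the induction step.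
\<close>

lemma newton_rem_eq_set_dd:
  assumes "y + x \<notin> grid y P"
  shows "newton_rem P f x y = (\<Prod>i<P. x - real i) * set_dd f (insert (y + x) (grid y P))"
  using assms
proof (induction P)
  case 0
  show ?case by (simp add: newton_rem_def set_dd_def)
next
  case (Suc P)
  have new: "y + x \<notin> grid y P" "x \<noteq> real P" using Suc.prems by (auto simp: grid_Suc)
  have ex: "set_dd f (insert (y + x) (grid y P)) - set_dd f (grid y (Suc P))
      = (x - real P) * set_dd f (insert (y + x) (grid y (Suc P)))"
    using new set_dd_exchange[of "grid y P" "y + x" "y + real P" f]
    by (auto simp: grid_Suc dest: grid_less)
  have "newton_rem (Suc P) f x y = newton_rem P f x y - (x gchoose P) * (fwd_diff ^^ P) f y"
    by (simp add: newton_rem_def)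
  also have "(x gchoose P) * (fwd_diff ^^ P) f y = (\<Prod>i<P. x - real i) * set_dd f (grid y (Suc P))"
    by (simp add: gbinomial_prod_rev set_dd_grid lessThan_atLeast0)
  finally show ?case
    using ex new by (simp add: Suc.IH right_diff_distrib[symmetric])
qed

text \<open>
  Interpolation is exact at its nodes.  This covers the points excluded by the error
  formula, and it follows from that formula with the grid that ends just before the node.
\<close>

lemma newton_rem_nat:
  assumes "i < P"
  shows "newton_rem P f (real i) y = 0"
proof -
  have "y + real i \<notin> grid y i" by (auto simp: grid_def)
  hence "newton_rem i f (real i) y = (\<Prod>k<i. real i - real k) * set_dd f (grid y (Suc i))"
    by (simp add: newton_rem_eq_set_dd grid_Suc)
  also have "\<dots> = (real i gchoose i) * (fwd_diff ^^ i) f y"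
    by (simp add: gbinomial_prod_rev set_dd_grid lessThan_atLeast0)
  finally have "f (y + real i) = (\<Sum>j<Suc i. (real i gchoose j) * (fwd_diff ^^ j) f y)"
    by (simp add: newton_rem_def)
  also have "\<dots> = (\<Sum>j<P. (real i gchoose j) * (fwd_diff ^^ j) f y)"
    using assms
    by (intro sum.mono_neutral_left) (auto simp: binomial_gbinomial[symmetric] binomial_eq_0)
  finally show ?thesis by (simp add: newton_rem_def)
qed

section \<open>Convexity up to a sign\<close>

text \<open>
  With \<open>s = 1\<close> this is convexity and with \<open>s = -1\<close> concavity of order \<open>p\<close>, so that one proof serves
  both cases of the theorem.
\<close>

definition signed_convex :: "real \<Rightarrow> nat \<Rightarrow> real \<Rightarrow> (real \<Rightarrow> real) \<Rightarrow> bool" where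
  "signed_convex s p b f \<longleftrightarrow>
     (\<forall>S. finite S \<longrightarrow> S \<subseteq> {b..} \<longrightarrow> card S = p + 2 \<longrightarrow> 0 \<le> s * set_dd f S)"

lemma signed_convexD:
  "signed_convex s p b f \<Longrightarrow> finite S \<Longrightarrow> S \<subseteq> {b..} \<Longrightarrow> card S = p + 2 \<Longrightarrow> 0 \<le> s * set_dd f S"
  by (auto simp: signed_convex_def)

text \<open>
  Moving a node to the right increases a divided difference of order \<open>p\<close>, by \<open>set_dd_exchange\<close>.
  The nodes of \<open>S\<close> outside \<open>T\<close> are moved one at a time onto the nodes of \<open>T\<close> outside \<open>S\<close>; the
  order is only required between these two sets because that condition survives every move.
\<close>

lemma set_dd_mono:
  assumes "signed_convex s p b f"
    and "finite S" "finite T" "S \<subseteq> {b..}" "T \<subseteq> {b..}" "card S = Suc p" "card T = Suc p"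
    and "\<And>u v. u \<in> S - T \<Longrightarrow> v \<in> T - S \<Longrightarrow> u \<le> v"
  shows "s * set_dd f S \<le> s * set_dd f T"
  using assms(2-)
proof (induction "card (S - T)" arbitrary: S)
  case 0
  hence "S \<subseteq> T" by auto
  hence "S = T" using 0 by (simp add: card_subset_eq)
  thus ?case by simp
next
  case (Suc k)
  obtain u where u: "u \<in> S - T" using Suc.hyps(2) by (metis card.empty ex_in_conv nat.distinct(1))
  have "\<not> T \<subseteq> S" using Suc.prems u card_subset_eq[of S T] by auto
  then obtain v where v: "v \<in> T - S" by auto
  define R where "R = S - {u}"
  have S: "S = insert u R" "u \<notin> R" "finite R" "v \<notin> R" "v \<noteq> u"
    using u v Suc.prems by (auto simp: R_def)
  have "insert v R - T = S - T - {u}" using u v by (auto simp: R_def)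
  hence "card (insert v R - T) = k" using Suc.hyps(2) u Suc.prems by simp
  hence "s * set_dd f (insert v R) \<le> s * set_dd f T"
    using S u v Suc.prems by (intro Suc.hyps(1)) auto
  moreover have "s * set_dd f (insert u R) \<le> s * set_dd f (insert v R)"
  proof -
    have "set_dd f (insert v R) - set_dd f (insert u R) = (v - u) * set_dd f (insert v (insert u R))"
      using S by (intro set_dd_exchange) auto
    hence "s * set_dd f (insert v R) - s * set_dd f (insert u R)
        = (v - u) * (s * set_dd f (insert v (insert u R)))"
      by (simp add: right_diff_distrib[symmetric])
    moreover have "0 \<le> s * set_dd f (insert v (insert u R))"
      using S u v Suc.prems by (intro signed_convexD[OF assms(1)]) auto
    moreover have "u \<le> v" using Suc.prems u v by blast
    ultimately show ?thesis by (smt (verit) mult_nonneg_nonneg)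
  qed
  ultimately show ?case using S by simp
qed

text \<open>
  By \<open>newton_rem_eq_set_dd\<close> and one exchange, the remainder is a fixed multiple of the growth of a
  divided difference of order \<open>p\<close> when the node \<open>y\<close> is moved to \<open>y + x\<close>.  Moving the whole grid beyond all
  nodes involved increases that divided difference further, so the growth is dominated by
  a difference of two values of \<open>\<Delta>\<^sup>p f\<close>.
\<close>

lemma newton_rem_bound:
  assumes "signed_convex s p b f" "\<bar>s\<bar> = 1" "b \<le> y" "0 < x" "x \<le> real N" "p < N"
  shows "\<bar>newton_rem (Suc p) f x y\<bar>
    \<le> \<bar>(x - 1) gchoose p\<bar> * (s * ((fwd_diff ^^ p) f (y + real N) - (fwd_diff ^^ p) f y))"
proof -
  define u where "u = s * set_dd f (grid y (Suc p))"
  define v where "v = s * set_dd f (grid (y + real N) (Suc p))"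
  have uv: "s * ((fwd_diff ^^ p) f (y + real N) - (fwd_diff ^^ p) f y) = fact p * (v - u)"
    by (simp add: u_def v_def fwd_diff_pow_eq_set_dd algebra_simps)
  have far: "z \<le> y + real N" if "z \<in> grid y (Suc p)" for z
  proof -
    have "z < y + real (Suc p)" using that by (rule grid_less)
    moreover have "real (Suc p) \<le> real N" using assms by simp
    ultimately show ?thesis by linarith
  qed
  have le: "u \<le> v"
    unfolding u_def v_def using assms far
    by (intro set_dd_mono[OF assms(1)]) (force dest: grid_ge)+
  show ?thesis
  proof (cases "y + x \<in> grid y (Suc p)")
    case True
    then obtain i where "i < Suc p" "x = real i" by (auto simp: grid_def)
    thus ?thesis using le by (simp add: newton_rem_nat uv)
  next
    case False
    \<comment> \<open>the nodes of the grid from \<open>y\<close> after the first of them is moved to \<open>y + x\<close>\<close>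
    define R where "R = insert (y + x) (grid (y + 1) p)"
    have new: "y + x \<notin> grid (y + 1) p" "y \<notin> grid (y + 1) p"
      using False by (auto simp: grid_Suc_left dest: grid_ge)
    define w where "w = s * set_dd f R"
    have "u \<le> w"
      unfolding u_def w_def using assms new
      by (intro set_dd_mono[OF assms(1)]) (auto simp: R_def grid_Suc_left dest!: grid_ge)
    have far': "z \<le> y + real N" if "z \<in> R" for z
      using that far assms by (auto simp: R_def grid_Suc_left)
    have "w \<le> v"
      unfolding v_def w_def using assms new far'
      by (intro set_dd_mono[OF assms(1)]) (simp_all add: R_def, (force dest: grid_ge)+)
    have "set_dd f R - set_dd f (grid y (Suc p)) = x * set_dd f (insert (y + x) (grid y (Suc p)))"
      using set_dd_exchange[of "grid (y + 1) p" "y + x" y f] new assms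
      by (simp add: R_def grid_Suc_left)
    moreover have "(\<Prod>i<Suc p. x - real i) = x * (fact p * ((x - 1) gchoose p))"
      unfolding prod.lessThan_Suc_shift by (simp add: gbinomial_prod_rev lessThan_atLeast0 algebra_simps)
    ultimately have "newton_rem (Suc p) f x y
        = (fact p * ((x - 1) gchoose p)) * (set_dd f R - set_dd f (grid y (Suc p)))"
      using False by (simp add: newton_rem_eq_set_dd)
    hence "\<bar>newton_rem (Suc p) f x y\<bar>
        = \<bar>(x - 1) gchoose p\<bar> * (fact p * \<bar>s * (set_dd f R - set_dd f (grid y (Suc p)))\<bar>)"
      using assms(2) by (simp add: abs_mult)
    also have "s * (set_dd f R - set_dd f (grid y (Suc p))) = w - u"
      by (simp add: w_def u_def algebra_simps)
    also have "\<bar>w - u\<bar> \<le> v - u" using \<open>u \<le> w\<close> \<open>w \<le> v\<close> by simp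
    finally show ?thesis unfolding uv by (simp add: mult_left_mono)
  qed
qed

section \<open>The classes of eventually convex and concave functions\<close>

lemma divided_diff_eq_set_dd:
  assumes "strict_mono_on {..n} x"
  shows "divided_diff f x n = set_dd f (x ` {..n})"
proof -
  have inj: "inj_on x {..n}" using assms by (rule strict_mono_on_imp_inj_on)
  have "(\<Prod>y\<in>x ` {..n} - {x k}. x k - y) = (\<Prod>j\<in>{..n} - {k}. x k - x j)" if "k \<le> n" for k
  proof -
    have "x ` {..n} - {x k} = x ` ({..n} - {k})"
      using inj that by (auto simp: inj_on_def)
    thus ?thesis using inj by (simp add: prod.reindex inj_on_diff)
  qed
  thus ?thesis
    using inj by (simp add: divided_diff_def set_dd_def sum.reindex)
qed

lemma obtain_strict_mono_enumeration:
  fixes S :: "real set"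
  assumes "finite S" "card S = Suc n"
  obtains x :: "nat \<Rightarrow> real" where "strict_mono_on {..n} x" "x ` {..n} = S"
proof
  define l where "l = sorted_list_of_set S"
  have l: "length l = Suc n" "set l = S" using assms by (auto simp: l_def)
  show "strict_mono_on {..n} (\<lambda>i. l ! i)"
    using l(1) strict_sorted_list_of_set[of S]
    by (auto simp: strict_mono_on_def l_def sorted_wrt_nth_less)
  show "(\<lambda>i. l ! i) ` {..n} = S"
    using l by (auto simp: in_set_conv_nth less_Suc_eq_le image_iff set_conv_nth)
qed

lemma p_convex_on_iff: "p_convex_on (int p) {b..} f \<longleftrightarrow> signed_convex 1 p b f"
proof -
  have n: "nat (int p + 1) = Suc p" by simp
  show ?thesis
    unfolding p_convex_on_def signed_convex_def n
  proof safe
    fix S :: "real set"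
    assume *: "\<forall>x. strict_mono_on {..Suc p} x \<longrightarrow> x ` {..Suc p} \<subseteq> {b..} \<longrightarrow> 0 \<le> divided_diff f x (Suc p)"
      and S: "finite S" "S \<subseteq> {b..}" "card S = p + 2"
    obtain x where "strict_mono_on {..Suc p} x" "x ` {..Suc p} = S"
      using S by (auto elim: obtain_strict_mono_enumeration[of S "Suc p"])
    thus "0 \<le> 1 * set_dd f S" using * S by (metis divided_diff_eq_set_dd mult_1)
  next
    fix x :: "nat \<Rightarrow> real"
    assume *: "\<forall>S. finite S \<longrightarrow> S \<subseteq> {b..} \<longrightarrow> card S = p + 2 \<longrightarrow> 0 \<le> 1 * set_dd f S"
      and x: "strict_mono_on {..Suc p} x" "x ` {..Suc p} \<subseteq> {b..}"
    have "card (x ` {..Suc p}) = p + 2"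
      using card_image[OF strict_mono_on_imp_inj_on[OF x(1)]] by simp
    thus "0 \<le> divided_diff f x (Suc p)" using * x by (simp add: divided_diff_eq_set_dd)
  qed
qed

lemma p_concave_on_iff: "p_concave_on (int p) {b..} f \<longleftrightarrow> signed_convex (-1) p b f"
proof -
  have "p_concave_on (int p) {b..} f \<longleftrightarrow> p_convex_on (int p) {b..} (\<lambda>x. - f x)"
    by (simp add: p_concave_on_def p_convex_on_def divided_diff_def sum_negf)
  thus ?thesis by (simp add: p_convex_on_iff signed_convex_def set_dd_uminus)
qed

definition K_signed :: "real \<Rightarrow> nat \<Rightarrow> (real \<Rightarrow> real) set" where
  "K_signed s p = {f. \<exists>b>0. signed_convex s p b f}"

lemma K_plus_eq: "K_plus (int p) = K_signed 1 p"
  by (simp add: K_plus_def K_signed_def p_convex_on_iff)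

lemma K_minus_eq: "K_minus (int p) = K_signed (-1) p"
  by (simp add: K_minus_def K_signed_def p_concave_on_iff)

lemma K_class_iff: "f \<in> K_class (int p) \<longleftrightarrow> (\<exists>s. \<bar>s\<bar> = 1 \<and> f \<in> K_signed s p)"
proof -
  have "\<bar>s\<bar> = 1 \<longleftrightarrow> s = 1 \<or> s = -1" for s :: real by auto
  thus ?thesis by (auto simp: K_class_def K_plus_eq K_minus_eq)
qed

text \<open>
  Only values on the positive half-line matter, and constants have vanishing divided differences.
\<close>

lemma K_signed_cong_const:
  assumes "f \<in> K_signed s p" "\<And>x. x > 0 \<Longrightarrow> g x = f x + c"
  shows "g \<in> K_signed s p"
proof -
  obtain b where b: "b > 0" "signed_convex s p b f" using assms(1) by (auto simp: K_signed_def)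
  have "signed_convex s p b g"
    unfolding signed_convex_def
  proof safe
    fix S assume S: "finite S" "S \<subseteq> {b..}" "card S = p + 2"
    have "set_dd g S = set_dd (\<lambda>x. f x + c) S"
      using S b by (intro set_dd_cong assms(2)) force
    also have "\<dots> = set_dd f S" using S by (simp add: set_dd_add set_dd_const)
    finally show "0 \<le> s * set_dd g S" using signed_convexD[OF b(2)] S by simp
  qed
  thus ?thesis using b by (auto simp: K_signed_def)
qed

lemma K_signed_affine:
  assumes "f \<in> K_signed s p" "c > 0"
  shows "(\<lambda>x. f (c * x + d)) \<in> K_signed s p"
proof -
  obtain b where b: "b > 0" "signed_convex s p b f" using assms(1) by (auto simp: K_signed_def)
  \<comment> \<open>the absolute value ensures \<open>c x + d \<ge> b\<close> and keeps the bound positive even if \<open>d > b\<close>\<close>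
  define b' where "b' = (b + \<bar>d\<bar>) / c"
  have "signed_convex s p b' (\<lambda>x. f (c * x + d))"
    unfolding signed_convex_def
  proof safe
    fix S assume S: "finite S" "S \<subseteq> {b'..}" "card S = p + 2"
    have "b \<le> c * x + d" if "x \<in> S" for x
    proof -
      have "b' \<le> x" using S that by auto
      hence "b + \<bar>d\<bar> \<le> c * x" using assms by (simp add: b'_def field_simps)
      thus ?thesis by linarith
    qed
    moreover have "card ((\<lambda>x. c * x + d) ` S) = p + 2"
      using assms S by (subst card_image) (auto simp: inj_on_def)
    ultimately have "0 \<le> s * set_dd f ((\<lambda>x. c * x + d) ` S)"
      using S by (intro signed_convexD[OF b(2)]) auto
    hence "0 \<le> c ^ (card S - 1) * (s * set_dd f ((\<lambda>x. c * x + d) ` S))"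
      by (rule mult_nonneg_nonneg[rotated]) (use assms in simp)
    thus "0 \<le> s * set_dd (\<lambda>x. f (c * x + d)) S"
      using assms S by (simp add: set_dd_affine mult.left_commute)
  qed
  moreover have "b' > 0" using b assms by (simp add: b'_def add_pos_nonneg)
  ultimately show ?thesis by (auto simp: K_signed_def)
qed

section \<open>Vanishing differences\<close>

text \<open>
  Membership in \<open>D_class\<close> only speaks of integer grids.  By monotonicity, an arbitrary set of nodes
  lies between an integer grid to its left and one to its right, so all divided differences
  of order \<open>p\<close> with distant nodes are small.
\<close>

lemma set_dd_eventually_small:
  assumes "g \<in> D_class p" "g \<in> K_signed s p" "\<bar>s\<bar> = 1" "\<epsilon> > 0"
  shows "\<exists>B. \<forall>S. finite S \<longrightarrow> S \<subseteq> {B..} \<longrightarrow> card S = Suc p \<longrightarrow> \<bar>set_dd g S\<bar> < \<epsilon>"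
proof -
  obtain b where b: "b > 0" "signed_convex s p b g" using assms(2) by (auto simp: K_signed_def)
  have "(\<lambda>n. (fwd_diff ^^ p) g (real n) / fact p) \<longlonglongrightarrow> 0 / fact p"
    using assms(1) by (intro tendsto_intros) (auto simp: D_class_def)
  hence "(\<lambda>n. set_dd g (grid (real n) (Suc p))) \<longlonglongrightarrow> 0"
    by (simp add: set_dd_grid)
  then obtain n0 where n0: "\<And>n. n \<ge> n0 \<Longrightarrow> \<bar>set_dd g (grid (real n) (Suc p))\<bar> < \<epsilon>"
    using assms(4) by (auto simp: LIMSEQ_iff)
  define n1 where "n1 = max n0 (nat \<lceil>b\<rceil>)"
  have n1: "n1 \<ge> n0" "real n1 \<ge> b" by (auto simp: n1_def; linarith)+
  show ?thesis
  proof (intro exI[of _ "real n1 + real (Suc p)"] allI impI)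
    fix S assume S: "finite S" "S \<subseteq> {real n1 + real (Suc p)..}" "card S = Suc p"
    define n2 where "n2 = max n1 (nat \<lceil>Max S\<rceil>)"
    have n2: "n2 \<ge> n1" "\<And>x. x \<in> S \<Longrightarrow> x \<le> real n2"
    proof -
      fix x assume "x \<in> S"
      hence "x \<le> Max S" using S by simp
      thus "x \<le> real n2" unfolding n2_def by linarith
    qed (simp add: n2_def)
    have Sb: "S \<subseteq> {b..}" using S n1 by force
    have gb: "grid (real n) (Suc p) \<subseteq> {b..}" if "n \<ge> n1" for n
    proof
      fix z assume "z \<in> grid (real n) (Suc p)"
      hence "real n \<le> z" by (rule grid_ge)
      thus "z \<in> {b..}" using that n1 by simp
    qed
    have "s * set_dd g (grid (real n1) (Suc p)) \<le> s * set_dd g S"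
      using S Sb gb by (intro set_dd_mono[OF b(2)]) (force dest: grid_less)+
    moreover have "s * set_dd g S \<le> s * set_dd g (grid (real n2) (Suc p))"
      using S Sb gb n2 by (intro set_dd_mono[OF b(2)]) (force dest: grid_ge)+
    moreover have "\<bar>s * set_dd g (grid (real n1) (Suc p))\<bar> < \<epsilon>"
      "\<bar>s * set_dd g (grid (real n2) (Suc p))\<bar> < \<epsilon>"
      using n0[of n1] n0[of n2] n1 n2 assms(3) by (auto simp: abs_mult)
    ultimately have "\<bar>s * set_dd g S\<bar> < \<epsilon>" by linarith
    thus "\<bar>set_dd g S\<bar> < \<epsilon>" using assms(3) by (simp add: abs_mult)
  qed
qed

text \<open>
  An affine substitution turns integer grids into grids of another step and offset, on which
  the divided differences are still small by \<open>set_dd_eventually_small\<close>.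
\<close>

lemma D_class_affine:
  assumes "g \<in> D_class p" "g \<in> K_class (int p)" "c > 0"
  shows "(\<lambda>x. g (c * x + d)) \<in> D_class p"
proof -
  obtain s where s: "\<bar>s\<bar> = 1" "g \<in> K_signed s p" using assms(2) by (auto simp: K_class_iff)
  have "(\<lambda>n. set_dd g ((\<lambda>x. c * x + d) ` grid (real n) (Suc p))) \<longlonglongrightarrow> 0"
  proof (rule LIMSEQ_I)
    fix \<epsilon> :: real assume "\<epsilon> > 0"
    then obtain B where B: "\<And>S. finite S \<Longrightarrow> S \<subseteq> {B..} \<Longrightarrow> card S = Suc p \<Longrightarrow> \<bar>set_dd g S\<bar> < \<epsilon>"
      using set_dd_eventually_small[OF assms(1) s(2,1)] by meson
    show "\<exists>no. \<forall>n\<ge>no. norm (set_dd g ((\<lambda>x. c * x + d) ` grid (real n) (Suc p)) - 0) < \<epsilon>"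
    proof (intro exI[of _ "nat \<lceil>(B - d) / c\<rceil>"] allI impI)
      fix n assume "nat \<lceil>(B - d) / c\<rceil> \<le> n"
      hence "(B - d) / c \<le> real n" by linarith
      hence "B \<le> c * z + d" if "z \<in> grid (real n) (Suc p)" for z
        using grid_ge[OF that] assms(3) by (smt (verit) pos_divide_le_eq mult.commute)
      thus "norm (set_dd g ((\<lambda>x. c * x + d) ` grid (real n) (Suc p)) - 0) < \<epsilon>"
        using assms(3) by (auto intro!: B simp: card_image inj_on_def)
    qed
  qed
  hence "(\<lambda>n. fact p * (c ^ p * set_dd g ((\<lambda>x. c * x + d) ` grid (real n) (Suc p)))) \<longlonglongrightarrow> fact p * (c ^ p * 0)"
    by (intro tendsto_intros)
  thus ?thesis
    using assms(3) by (simp add: D_class_def fwd_diff_pow_eq_set_dd set_dd_affine)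
qed

lemma D_class_cong:
  assumes "g \<in> D_class p" "\<And>x. x > 0 \<Longrightarrow> g x = f x"
  shows "f \<in> D_class p"
proof -
  have "(fwd_diff ^^ p) g (real n) = (fwd_diff ^^ p) f (real n)" if "n > 0" for n
    unfolding fwd_diff_pow_eq_set_dd using that
    by (auto intro!: set_dd_cong assms(2) dest!: grid_ge)
  moreover have "\<forall>\<^sub>F n in sequentially. n > (0::nat)" by (rule eventually_gt_at_top)
  ultimately have "\<forall>\<^sub>F n in sequentially. (fwd_diff ^^ p) g (real n) = (fwd_diff ^^ p) f (real n)"
    by (metis (mono_tags, lifting) eventually_mono)
  from tendsto_cong[OF this] assms(1) show ?thesis by (simp add: D_class_def)
qed

lemma D_class_mono:
  assumes "g \<in> D_class p" "p \<le> q"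
  shows "g \<in> D_class q"
  using assms(2)
proof (induction q rule: dec_induct)
  case base
  show ?case by fact
next
  case (step q)
  hence *: "(\<lambda>n. (fwd_diff ^^ q) g (real n)) \<longlonglongrightarrow> 0" by (simp add: D_class_def)
  have "(\<lambda>n. (fwd_diff ^^ q) g (real (Suc n)) - (fwd_diff ^^ q) g (real n)) \<longlonglongrightarrow> 0 - 0"
    by (intro tendsto_diff * LIMSEQ_Suc[OF *])
  thus ?case by (simp add: D_class_def fwd_diff_def add.commute)
qed

section \<open>Vanishing Newton remainders and uniqueness\<close>

definition newton_null :: "nat \<Rightarrow> (real \<Rightarrow> real) \<Rightarrow> bool" where
  "newton_null P f \<longleftrightarrow> (\<forall>x>0. (\<lambda>n. newton_rem P f x (real n)) \<longlonglongrightarrow> 0)"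

lemma newton_rem_diff:
  "newton_rem P (\<lambda>x. f x - g x) x y = newton_rem P f x y - newton_rem P g x y"
  by (simp add: newton_rem_def fwd_diff_pow_eq_set_dd set_dd_diff algebra_simps
      sum_subtractf)

lemma newton_rem_Suc:
  "newton_rem (Suc P) f x y = newton_rem P f x y - (x gchoose P) * (fwd_diff ^^ P) f y"
  by (simp add: newton_rem_def)

lemma newton_null_Suc:
  assumes "newton_null P f" "f \<in> D_class P"
  shows "newton_null (Suc P) f"
  unfolding newton_null_def
proof safe
  fix x :: real assume "x > 0"
  hence "(\<lambda>n. newton_rem P f x (real n) - (x gchoose P) * (fwd_diff ^^ P) f (real n))
      \<longlonglongrightarrow> 0 - (x gchoose P) * 0"
    using assms by (intro tendsto_intros) (auto simp: newton_null_def D_class_def)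
  thus "(\<lambda>n. newton_rem (Suc P) f x (real n)) \<longlonglongrightarrow> 0" by (simp add: newton_rem_Suc)
qed

lemma D_class_fwd_diff: "fwd_diff f \<in> D_class p \<longleftrightarrow> f \<in> D_class (Suc p)"
  by (simp add: D_class_def funpow_Suc_right del: funpow.simps)

text \<open>
  A remainder of higher order subtracts further Newton terms, which vanish with the differences of \<open>f\<close>.
\<close>

lemma newton_null_mono:
  assumes "newton_null P f" "f \<in> D_class P" "P \<le> Q"
  shows "newton_null Q f"
  using assms(3)
  by (induction Q rule: dec_induct) (auto intro!: newton_null_Suc assms D_class_mono[OF assms(2)])

lemma eventually_newton_rem_bound:
  assumes "f \<in> K_signed s p" "\<bar>s\<bar> = 1" "x > 0"
  obtains N where "\<forall>\<^sub>F n in sequentially. \<bar>newton_rem (Suc p) f x (real n)\<bar> \<le> \<bar>(x - 1) gchoose p\<bar>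
      * (s * ((fwd_diff ^^ p) f (real (n + N)) - (fwd_diff ^^ p) f (real n)))"
proof
  obtain b where b: "b > 0" "signed_convex s p b f" using assms(1) by (auto simp: K_signed_def)
  \<comment> \<open>far enough that the grid from \<open>n + N\<close> lies beyond \<open>n + x\<close> and beyond the grid from \<open>n\<close>\<close>
  define N where "N = max (nat \<lceil>x\<rceil>) (Suc p)"
  have N: "x \<le> real N" "p < N" by (auto simp: N_def; linarith)+
  show "\<forall>\<^sub>F n in sequentially. \<bar>newton_rem (Suc p) f x (real n)\<bar> \<le> \<bar>(x - 1) gchoose p\<bar>
      * (s * ((fwd_diff ^^ p) f (real (n + N)) - (fwd_diff ^^ p) f (real n)))"
    using eventually_ge_at_top[of "nat \<lceil>b\<rceil>"]
  proof eventually_elim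
    case (elim n)
    hence "b \<le> real n" by linarith
    from newton_rem_bound[OF b(2) assms(2) this assms(3) N] show ?case by simp
  qed
qed

lemma shift_diff_sum: "u (n + N) - u n = (\<Sum>k<N. u (Suc (n + k)) - u (n + k))"
  for u :: "nat \<Rightarrow> real"
  using sum_lessThan_telescope[of "\<lambda>k. u (n + k)" N] by simp

text \<open>
  Up to a constant factor, the bound of \<open>newton_rem_bound\<close> is a sum of \<open>N\<close> values of \<open>\<Delta>\<^sup>p\<^sup>+\<^sup>1 f\<close> at \<open>n, \<dots>, n + N - 1\<close>, each of which
  tends to zero.
\<close>

lemma newton_null_K_class:
  assumes "f \<in> K_class (int p)" "f \<in> D_class (Suc p)"
  shows "newton_null (Suc p) f"
  unfolding newton_null_def
proof safe
  fix x :: real assume x: "x > 0"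
  obtain s where s: "\<bar>s\<bar> = 1" "f \<in> K_signed s p" using assms(1) by (auto simp: K_class_iff)
  obtain N where N: "\<forall>\<^sub>F n in sequentially. \<bar>newton_rem (Suc p) f x (real n)\<bar> \<le> \<bar>(x - 1) gchoose p\<bar>
      * (s * ((fwd_diff ^^ p) f (real (n + N)) - (fwd_diff ^^ p) f (real n)))"
    using eventually_newton_rem_bound[OF s(2,1) x] .
  define u where "u n = (fwd_diff ^^ p) f (real n)" for n
  have "(\<lambda>n. u (Suc n) - u n) \<longlonglongrightarrow> 0"
    using assms(2) by (simp add: u_def D_class_def fwd_diff_def add.commute)
  hence "(\<lambda>n. \<Sum>k<N. u (Suc (n + k)) - u (n + k)) \<longlonglongrightarrow> (\<Sum>k<N. 0)"
    by (intro tendsto_sum) (rule LIMSEQ_ignore_initial_segment)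
  hence "(\<lambda>n. u (n + N) - u n) \<longlonglongrightarrow> 0"
    by (simp add: shift_diff_sum[symmetric])
  hence "(\<lambda>n. \<bar>(x - 1) gchoose p\<bar> * (s * (u (n + N) - u n))) \<longlonglongrightarrow> \<bar>(x - 1) gchoose p\<bar> * (s * 0)"
    by (intro tendsto_intros)
  hence "(\<lambda>n. \<bar>(x - 1) gchoose p\<bar> * (s * (u (n + N) - u n))) \<longlonglongrightarrow> 0" by simp
  thus "(\<lambda>n. newton_rem (Suc p) f x (real n)) \<longlonglongrightarrow> 0"
  proof (rule tendsto_0_le[where K = 1])
    show "\<forall>\<^sub>F n in sequentially. norm (newton_rem (Suc p) f x (real n))
        \<le> norm (\<bar>(x - 1) gchoose p\<bar> * (s * (u (n + N) - u n))) * 1"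
      using N unfolding u_def real_norm_def mult_1_right
      by eventually_elim (rule order_trans[OF _ abs_ge_self])
  qed
qed

text \<open>
  The difference \<open>d = f - g\<close> has period one.  On an integer grid it is constant, so its
  interpolating polynomial is the constant \<open>d 1\<close> and its remainder is \<open>d x - d 1\<close> for every \<open>n\<close>.
\<close>

lemma newton_null_unique:
  assumes "newton_null (Suc P) f" "newton_null (Suc P) g"
    and eq: "\<And>x. x > 0 \<Longrightarrow> f (x + 1) - f x = g (x + 1) - g x"
    and "x > 0"
  shows "f x = g x + (f 1 - g 1)"
proof -
  define d where "d x = f x - g x" for x
  have per: "d (y + real k) = d y" if "y > 0" for y k
  proof (induction k)
    case (Suc k)
    have "d (y + real k + 1) = d (y + real k)"
      using eq[of "y + real k"] that by (simp add: d_def)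
    with Suc show ?case by (simp add: algebra_simps)
  qed simp
  have "newton_rem (Suc P) d x (real n) = d x - d 1" if "n > 0" for n
  proof -
    have n: "d (real n + real i) = d 1" for i
      using per[of 1 "n - 1 + i"] that by (simp add: algebra_simps of_nat_diff)
    have diff0: "(fwd_diff ^^ Suc j) d (real n) = 0" for j
    proof -
      have "set_dd d (grid (real n) (Suc (Suc j))) = set_dd (\<lambda>_. d 1) (grid (real n) (Suc (Suc j)))"
        by (rule set_dd_cong) (auto simp: grid_def n)
      thus ?thesis by (simp add: fwd_diff_pow_eq_set_dd set_dd_const del: funpow.simps)
    qed
    have "(\<Sum>j<Suc P. (x gchoose j) * (fwd_diff ^^ j) d (real n)) = d 1"
      unfolding sum.lessThan_Suc_shift diff0 using n[of 0] by simp
    moreover have "d (real n + x) = d x" using per[of x n] assms by (simp add: add.commute)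
    ultimately show ?thesis by (simp add: newton_rem_def)
  qed
  hence "\<forall>\<^sub>F n in sequentially. newton_rem (Suc P) d x (real n) = d x - d 1"
    using eventually_gt_at_top[of "0::nat"] by (metis (mono_tags, lifting) eventually_mono)
  hence "(\<lambda>n. newton_rem (Suc P) d x (real n)) \<longlonglongrightarrow> d x - d 1"
    by (simp add: tendsto_eventually)
  moreover have "(\<lambda>n. newton_rem (Suc P) f x (real n) - newton_rem (Suc P) g x (real n)) \<longlonglongrightarrow> 0 - 0"
    using assms by (intro tendsto_diff) (auto simp: newton_null_def)
  hence "(\<lambda>n. newton_rem (Suc P) d x (real n)) \<longlonglongrightarrow> 0"
    by (simp add: d_def[abs_def] newton_rem_diff)
  ultimately have "d x - d 1 = 0" by (rule LIMSEQ_unique)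
  thus ?thesis by (simp add: d_def)
qed

section \<open>The operator \<open>Sigma_op\<close>\<close>

text \<open>
  The increments of the defining sequence are Newton remainders; this identity is how
  convexity of \<open>g\<close> governs the convergence.
\<close>

lemma Sigma_seq_Suc:
  assumes "n \<ge> 1"
  shows "Sigma_seq p g x (Suc n) - Sigma_seq p g x n = - newton_rem (Suc p) g x (real n)"
proof -
  have "{1..<Suc n} = insert n {1..<n}" using assms by auto
  hence s1: "(\<Sum>k = 1..<Suc n. g (real k) - g (x + real k))
      = (\<Sum>k = 1..<n. g (real k) - g (x + real k)) + (g (real n) - g (x + real n))" by simp
  have s2: "(\<Sum>j = 1..p. (x gchoose j) * (fwd_diff ^^ (j - 1)) g (real (Suc n)))
      - (\<Sum>j = 1..p. (x gchoose j) * (fwd_diff ^^ (j - 1)) g (real n))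
      = (\<Sum>j = 1..p. (x gchoose j) * (fwd_diff ^^ j) g (real n))"
    unfolding sum_subtractf[symmetric]
  proof (rule sum.cong[OF refl])
    fix j assume "j \<in> {1..p}"
    then obtain i where "j = Suc i" by (cases j) auto
    thus "(x gchoose j) * (fwd_diff ^^ (j - 1)) g (real (Suc n))
        - (x gchoose j) * (fwd_diff ^^ (j - 1)) g (real n) = (x gchoose j) * (fwd_diff ^^ j) g (real n)"
      by (simp add: fwd_diff_def right_diff_distrib add.commute)
  qed
  have "{..<Suc p} = insert 0 {1..p}" by auto
  hence s3: "(\<Sum>j<Suc p. (x gchoose j) * (fwd_diff ^^ j) g (real n))
      = g (real n) + (\<Sum>j = 1..p. (x gchoose j) * (fwd_diff ^^ j) g (real n))" by simp
  show ?thesis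
    unfolding Sigma_seq_def newton_rem_def s1 s3 using s2 by (simp add: add.commute)
qed

text \<open>
  The bound of \<open>newton_rem_bound\<close> is a finite sum of telescoping series of the
  convergent sequence \<open>\<Delta>\<^sup>p g n\<close>.
\<close>

lemma Sigma_seq_summable:
  assumes "g \<in> D_class p" "g \<in> K_class (int p)" "x > 0"
  shows "summable (\<lambda>n. newton_rem (Suc p) g x (real n))"
proof -
  obtain s where s: "\<bar>s\<bar> = 1" "g \<in> K_signed s p" using assms(2) by (auto simp: K_class_iff)
  obtain N where N: "\<forall>\<^sub>F n in sequentially. \<bar>newton_rem (Suc p) g x (real n)\<bar> \<le> \<bar>(x - 1) gchoose p\<bar>
      * (s * ((fwd_diff ^^ p) g (real (n + N)) - (fwd_diff ^^ p) g (real n)))"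
    using eventually_newton_rem_bound[OF s(2,1) assms(3)] .
  define u where "u n = (fwd_diff ^^ p) g (real n)" for n
  have u: "u \<longlonglongrightarrow> 0" using assms(1) by (simp add: D_class_def u_def[abs_def])
  have "summable (\<lambda>n. \<Sum>k<N. u (Suc (n + k)) - u (n + k))"
  proof (rule summable_sum)
    fix k
    show "summable (\<lambda>n. u (Suc (n + k)) - u (n + k))"
      using telescope_summable[OF LIMSEQ_ignore_initial_segment[OF u, of k]] by simp
  qed
  hence "summable (\<lambda>n. \<bar>(x - 1) gchoose p\<bar> * (s * (u (n + N) - u n)))"
    unfolding shift_diff_sum[symmetric] by (intro summable_mult)
  thus ?thesis
    by (rule summable_comparison_test_ev[rotated]) (use N in \<open>simp add: u_def\<close>)
qed

lemma Sigma_seq_convergent: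
  assumes "g \<in> D_class p" "g \<in> K_class (int p)" "x > 0"
  shows "convergent (Sigma_seq p g x)"
proof -
  \<comment> \<open>the increment formula fails at \<open>n = 0\<close>, hence the shift by one\<close>
  have "summable (\<lambda>n. - newton_rem (Suc p) g x (real (Suc n)))"
    using Sigma_seq_summable[OF assms]
    by (intro summable_minus) (subst summable_Suc_iff[of "\<lambda>n. newton_rem (Suc p) g x (real n)"])
  hence "summable (\<lambda>n. Sigma_seq p g x (Suc (Suc n)) - Sigma_seq p g x (Suc n))"
    by (simp add: Sigma_seq_Suc)
  hence "convergent (\<lambda>n. \<Sum>k<n. Sigma_seq p g x (Suc (Suc k)) - Sigma_seq p g x (Suc k))"
    by (simp add: summable_iff_convergent)
  hence "convergent (\<lambda>n. Sigma_seq p g x (Suc n) - Sigma_seq p g x (Suc 0))"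
    using sum_lessThan_telescope[of "\<lambda>k. Sigma_seq p g x (Suc k)"] by simp
  hence "convergent (\<lambda>n. Sigma_seq p g x (Suc n))"
    by (simp only: convergent_diff_const_right_iff)
  thus ?thesis by (simp add: convergent_Suc_iff)
qed

text \<open>
  Raising the order by one adds a multiple of a vanishing difference.  Hence all admissible
  orders give the same limit, and the description in \<open>Sigma_op\<close> is unique.
\<close>

lemma Sigma_seq_tendsto_mono:
  assumes "g \<in> D_class p" "p \<le> q" "Sigma_seq p g x \<longlonglongrightarrow> L"
  shows "Sigma_seq q g x \<longlonglongrightarrow> L"
  using assms(2)
proof (induction q rule: dec_induct)
  case base
  show ?case by fact
next
  case (step q)
  have "(\<lambda>n. (fwd_diff ^^ q) g (real n)) \<longlonglongrightarrow> 0"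
    using D_class_mono[OF assms(1) step.hyps(1)] by (simp add: D_class_def)
  hence "(\<lambda>n. Sigma_seq q g x n + (x gchoose Suc q) * (fwd_diff ^^ q) g (real n))
      \<longlonglongrightarrow> L + (x gchoose Suc q) * 0"
    by (intro tendsto_intros step.IH)
  thus ?case by (simp add: Sigma_seq_def[abs_def] add.assoc)
qed

lemma Sigma_op_tendsto:
  assumes "g \<in> D_class p" "g \<in> K_class (int p)" "x > 0"
  shows "Sigma_seq p g x \<longlonglongrightarrow> Sigma_op g x"
proof -
  obtain L where L: "Sigma_seq p g x \<longlonglongrightarrow> L"
    using Sigma_seq_convergent[OF assms] by (auto simp: convergent_def)
  have "Sigma_op g x = L"
    unfolding Sigma_op_def
  proof (rule the_equality)
    show "\<exists>p. g \<in> D_class p \<inter> K_class (int p) \<and> Sigma_seq p g x \<longlonglongrightarrow> L"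
      using assms L by blast
  next
    fix M assume "\<exists>p. g \<in> D_class p \<inter> K_class (int p) \<and> Sigma_seq p g x \<longlonglongrightarrow> M"
    then obtain r where r: "g \<in> D_class r" "Sigma_seq r g x \<longlonglongrightarrow> M" by blast
    have "Sigma_seq (max p r) g x \<longlonglongrightarrow> L" "Sigma_seq (max p r) g x \<longlonglongrightarrow> M"
      using Sigma_seq_tendsto_mono[OF assms(1) _ L] Sigma_seq_tendsto_mono[OF r(1) _ r(2)] by auto
    thus "M = L" by (rule LIMSEQ_unique[rotated])
  qed
  with L show ?thesis by simp
qed

text \<open>
  By Pascal's rule the sequences at \<open>x + 1\<close> and at \<open>x\<close> differ by \<open>g x\<close> up to a Newton remainder of
  order \<open>p\<close>, which vanishes since the remainder of order \<open>p + 1\<close> is the term of a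
  convergent series.
\<close>

lemma Sigma_op_equation:
  assumes "g \<in> D_class p" "g \<in> K_class (int p)" "x > 0"
  shows "Sigma_op g (x + 1) - Sigma_op g x = g x"
proof -
  have step: "Sigma_seq p g (x + 1) n - Sigma_seq p g x n = g x - newton_rem p g x (real n)"
    if "n \<ge> 1" for n
  proof -
    have "(\<Sum>k = 1..<n. g (x + real k) - g (x + real (Suc k))) = g (x + 1) - g (x + real n)"
      using sum_Suc_diff'[of 1 n "\<lambda>k. - g (x + real k)"] that by simp
    hence s1: "(\<Sum>k = 1..<n. g (real k) - g (x + 1 + real k)) - (\<Sum>k = 1..<n. g (real k) - g (x + real k))
        = g (x + 1) - g (x + real n)"
      unfolding sum_subtractf[symmetric] by (simp add: algebra_simps)
    have "(\<Sum>j = 1..p. (x + 1 gchoose j) * (fwd_diff ^^ (j - 1)) g (real n))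
        - (\<Sum>j = 1..p. (x gchoose j) * (fwd_diff ^^ (j - 1)) g (real n))
        = (\<Sum>j = 1..p. (x gchoose (j - 1)) * (fwd_diff ^^ (j - 1)) g (real n))"
      unfolding sum_subtractf[symmetric] left_diff_distrib[symmetric]
    proof (rule sum.cong[OF refl])
      fix j assume "j \<in> {1..p}"
      then obtain i where "j = Suc i" by (cases j) auto
      thus "((x + 1 gchoose j) - (x gchoose j)) * (fwd_diff ^^ (j - 1)) g (real n)
          = (x gchoose (j - 1)) * (fwd_diff ^^ (j - 1)) g (real n)"
        by (simp add: gbinomial_Suc_Suc)
    qed
    also have "\<dots> = (\<Sum>j<p. (x gchoose j) * (fwd_diff ^^ j) g (real n))"
      by (rule sum.reindex_bij_witness[of _ Suc "\<lambda>j. j - 1"]) auto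
    finally show ?thesis
      using s1 by (simp add: Sigma_seq_def newton_rem_def add.commute)
  qed
  have "(\<lambda>n. newton_rem (Suc p) g x (real n)) \<longlonglongrightarrow> 0"
    by (rule summable_LIMSEQ_zero[OF Sigma_seq_summable[OF assms]])
  hence "(\<lambda>n. newton_rem (Suc p) g x (real n) + (x gchoose p) * (fwd_diff ^^ p) g (real n))
      \<longlonglongrightarrow> 0 + (x gchoose p) * 0"
    using assms(1) by (intro tendsto_intros) (auto simp: D_class_def)
  hence "(\<lambda>n. newton_rem p g x (real n)) \<longlonglongrightarrow> 0" by (simp add: newton_rem_Suc)
  hence "(\<lambda>n. g x - newton_rem p g x (real n)) \<longlonglongrightarrow> g x - 0" by (intro tendsto_intros)
  moreover have "\<forall>\<^sub>F n in sequentially.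
      Sigma_seq p g (x + 1) n - Sigma_seq p g x n = g x - newton_rem p g x (real n)"
    using eventually_ge_at_top[of "1::nat"] by eventually_elim (rule step)
  ultimately have "(\<lambda>n. Sigma_seq p g (x + 1) n - Sigma_seq p g x n) \<longlonglongrightarrow> g x"
    by (simp add: tendsto_cong)
  moreover have "(\<lambda>n. Sigma_seq p g (x + 1) n - Sigma_seq p g x n) \<longlonglongrightarrow> Sigma_op g (x + 1) - Sigma_op g x"
    using assms by (intro tendsto_diff Sigma_op_tendsto) auto
  ultimately show ?thesis by (rule LIMSEQ_unique[rotated])
qed

text \<open>
  The polynomial and constant parts of the defining sequence are annihilated by divided
  differences with \<open>p + 2\<close> nodes.  Minus a sum of translates of \<open>g\<close> remains, and its sign passes to
  the limit.
\<close>

lemma Sigma_op_K_signed: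
  assumes "g \<in> D_class p" "g \<in> K_signed s p" "\<bar>s\<bar> = 1"
  shows "Sigma_op g \<in> K_signed (- s) p"
proof -
  have K: "g \<in> K_class (int p)" using assms by (auto simp: K_class_iff)
  obtain b where b: "b > 0" "signed_convex s p b g" using assms(2) by (auto simp: K_signed_def)
  have "signed_convex (- s) p b (Sigma_op g)"
    unfolding signed_convex_def
  proof safe
    fix S assume S: "finite S" "S \<subseteq> {b..}" "card S = p + 2"
    have nonneg: "0 \<le> s * set_dd (\<lambda>x. g (x + real k)) S" for k
    proof -
      have "set_dd (\<lambda>x. g (x + real k)) S = set_dd g ((\<lambda>x. x + real k) ` S)"
        using set_dd_affine[of 1 S g "real k"] S by simp
      thus ?thesis
        using S by (auto intro!: signed_convexD[OF b(2)] simp: card_image)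
    qed
    have eq: "set_dd (\<lambda>x. Sigma_seq p g x n) S
        = - set_dd g S - (\<Sum>k = 1..<n. set_dd (\<lambda>x. g (x + real k)) S)" for n
    proof -
      have "set_dd (\<lambda>x. \<Sum>k = 1..<n. g (real k) - g (x + real k)) S
          = - (\<Sum>k = 1..<n. set_dd (\<lambda>x. g (x + real k)) S)"
        using S by (simp add: set_dd_sum set_dd_diff set_dd_const sum_negf)
      moreover have "set_dd (\<lambda>x. \<Sum>j = 1..p. (x gchoose j) * (fwd_diff ^^ (j - 1)) g (real n)) S = 0"
        unfolding set_dd_sum using S
        by (intro sum.neutral) (simp add: mult.commute[of "_ gchoose _"] set_dd_cmult set_dd_gbinomial)
      ultimately show ?thesis
        by (simp add: Sigma_seq_def set_dd_add set_dd_diff)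
    qed
    have "- s * set_dd (\<lambda>x. Sigma_seq p g x n) S
        = s * set_dd g S + (\<Sum>k = 1..<n. s * set_dd (\<lambda>x. g (x + real k)) S)" for n
      unfolding eq by (simp add: algebra_simps sum_distrib_left sum_negf)
    hence "0 \<le> - s * set_dd (\<lambda>x. Sigma_seq p g x n) S" for n
      using nonneg[of 0] nonneg by (simp add: sum_nonneg del: mult_minus_left)
    moreover have "(\<lambda>n. - s * set_dd (\<lambda>x. Sigma_seq p g x n) S) \<longlonglongrightarrow> - s * set_dd (Sigma_op g) S"
      using S b by (intro tendsto_mult tendsto_const set_dd_tendsto Sigma_op_tendsto assms K) force
    ultimately show "0 \<le> - s * set_dd (Sigma_op g) S" by (metis LIMSEQ_le_const)
  qed
  thus ?thesis using b by (auto simp: K_signed_def)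
qed

lemma K_signed_imp_K_class: "f \<in> K_signed s p \<Longrightarrow> \<bar>s\<bar> = 1 \<Longrightarrow> f \<in> K_class (int p)"
  by (auto simp: K_class_iff)

lemma newton_null_solution:
  assumes "f \<in> K_class (int p)" "g \<in> D_class p" "\<And>x. x > 0 \<Longrightarrow> f (x + 1) - f x = g x"
  shows "newton_null (Suc p) f" "f \<in> D_class (Suc p)"
proof -
  have "fwd_diff f \<in> D_class p"
    using assms by (intro D_class_cong[OF assms(2)]) (simp add: fwd_diff_def)
  thus "f \<in> D_class (Suc p)" by (simp add: D_class_fwd_diff)
  thus "newton_null (Suc p) f" by (rule newton_null_K_class[OF assms(1)])
qed

section \<open>The equation with arithmetic progressions\<close>

text \<open>
  Both cases of the theorem at once, for the sign \<open>s\<close>.  The concavity of \<open>F\<close> comes from the comparison of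
  \<open>F (c x)\<close> with \<open>\<Sigma> g\<^sub>m\<close>: the two are compared through remainders of order \<open>q + 1\<close>, the only
  order at which those of \<open>F (c x)\<close> are known to vanish beforehand.
\<close>

lemma sum_shift_eq_signed:
  fixes p q m :: nat and a s :: real and h F :: "real \<Rightarrow> real"
  assumes "m \<ge> 1" "a > 0" "q \<ge> p" and h: "h \<in> D_class q" "h \<in> K_class (int q)"
    and g: "fwd_diff (dilate h a) \<in> D_class p" "fwd_diff (dilate h a) \<in> K_signed s p" "\<bar>s\<bar> = 1"
    and F_def: "F = (\<lambda>x. Sigma_op (dilate h (a * real m)) ((x + a) / (a * real m))
                   - Sigma_op (dilate h (a * real m)) (x / (a * real m)))"
  shows "F \<in> K_signed (- s) p"
    and "\<And>x. x > 0 \<Longrightarrow> (\<Sum>j<m. F (x + a * real j)) = h x"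
    and "\<And>f x. f \<in> K_class (int p) \<Longrightarrow> (\<And>x. x > 0 \<Longrightarrow> (\<Sum>j<m. f (x + a * real j)) = h x)
           \<Longrightarrow> x > 0 \<Longrightarrow> f x = F x"
proof -
  define c where "c = a * real m"
  have c: "c > 0" and m: "real m > 0" using assms by (auto simp: c_def)
  define hc where "hc = dilate h c"
  define H where "H = Sigma_op hc"
  have F: "F x = H ((x + a) / c) - H (x / c)" for x
    by (simp add: F_def H_def hc_def c_def)
  obtain t where t: "\<bar>t\<bar> = 1" "h \<in> K_signed t q" using h(2) by (auto simp: K_class_iff)
  have dil: "hc = (\<lambda>x. h (c * x + 0))" by (simp add: hc_def dilate_def fun_eq_iff)
  have hcD: "hc \<in> D_class q" unfolding dil by (rule D_class_affine[OF h c])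
  have hcK: "hc \<in> K_signed t q" unfolding dil by (rule K_signed_affine[OF t(2) c])
  have hcK': "hc \<in> K_class (int q)" by (rule K_signed_imp_K_class[OF hcK t(1)])
  have HK: "H \<in> K_signed (- t) q" unfolding H_def by (rule Sigma_op_K_signed[OF hcD hcK t(1)])
  have H_eq: "H (x + 1) - H x = hc x" if "x > 0" for x
    unfolding H_def by (rule Sigma_op_equation[OF hcD hcK' that])

  show F_eq: "(\<Sum>j<m. F (x + a * real j)) = h x" if x: "x > 0" for x
  proof -
    have "F (x + a * real j) = H ((x + a * real (Suc j)) / c) - H ((x + a * real j) / c)" for j
      by (simp add: F algebra_simps)
    hence "(\<Sum>j<m. F (x + a * real j)) = H ((x + a * real m) / c) - H (x / c)"
      using sum_lessThan_telescope[of "\<lambda>j. H ((x + a * real j) / c)" m] by simp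
    also have "(x + a * real m) / c = x / c + 1" using c by (simp add: c_def[symmetric] add_divide_distrib)
    also have "H (x / c + 1) - H (x / c) = h x"
      using c x by (subst H_eq) (auto simp: hc_def dilate_def)
    finally show ?thesis .
  qed

  define gm where "gm x = fwd_diff (dilate h a) (real m * x)" for x
  have gK: "fwd_diff (dilate h a) \<in> K_class (int p)" by (rule K_signed_imp_K_class[OF g(2,3)])
  have gmD: "gm \<in> D_class p" and gmK: "gm \<in> K_signed s p"
    using D_class_affine[OF g(1) gK m, of 0] K_signed_affine[OF g(2) m, of 0]
    by (simp_all add: gm_def[abs_def])
  have gm_eq: "gm x = h (c * x + a) - h (c * x)" for x
    by (simp add: gm_def fwd_diff_def dilate_def c_def algebra_simps)

  \<comment> \<open>rescaling turns the step \<open>a m\<close> of the differenced equation into the step one\<close>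
  define phi where "phi f x = f (c * x)" for f :: "real \<Rightarrow> real" and x
  have phi_F: "phi F x = H (x + 1 / real m) - H x" for x
  proof -
    have "(c * x + a) / c = x + 1 / real m" using assms m by (simp add: c_def field_simps)
    thus ?thesis using c by (simp add: phi_def F)
  qed
  have phi_eq: "phi f (x + 1) - phi f x = gm x"
    if f: "\<And>x. x > 0 \<Longrightarrow> (\<Sum>j<m. f (x + a * real j)) = h x" and x: "x > 0" for f x
  proof -
    have "f (c * x + a * real m) - f (c * x)
        = (\<Sum>j<m. f (c * x + a * real (Suc j)) - f (c * x + a * real j))"
      using sum_lessThan_telescope[of "\<lambda>j. f (c * x + a * real j)" m] by simp
    also have "\<dots> = (\<Sum>j<m. f ((c * x + a) + a * real j)) - (\<Sum>j<m. f (c * x + a * real j))"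
      by (simp add: sum_subtractf algebra_simps)
    also have "\<dots> = gm x" using f[of "c * x + a"] f[of "c * x"] x c assms by (simp add: gm_eq add_pos_pos)
    finally show ?thesis by (simp add: phi_def c_def algebra_simps)
  qed

  have null_F: "newton_null (Suc q) (phi F)"
  proof -
    have HK': "H \<in> K_class (int q)" using HK t by (auto intro: K_signed_imp_K_class)
    have H'K: "(\<lambda>x. H (x + 1 / real m)) \<in> K_class (int q)"
      using K_signed_affine[OF HK, of 1 "1 / real m"] t by (auto intro: K_signed_imp_K_class)
    have hc'D: "(\<lambda>x. hc (x + 1 / real m)) \<in> D_class q"
      using D_class_affine[OF hcD hcK', of 1 "1 / real m"] by simp
    have "newton_null (Suc q) H"
      by (rule newton_null_solution[OF HK' hcD H_eq])
    moreover have "newton_null (Suc q) (\<lambda>x. H (x + 1 / real m))"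
    proof (rule newton_null_solution[OF H'K hc'D])
      fix x :: real assume "x > 0"
      hence "x + 1 / real m > 0" using m by (simp add: add_pos_pos)
      from H_eq[OF this] show "H (x + 1 + 1 / real m) - H (x + 1 / real m) = hc (x + 1 / real m)"
        by (simp add: add_ac)
    qed
    ultimately show ?thesis
      unfolding newton_null_def phi_F[abs_def] newton_rem_diff
      by (auto intro: tendsto_eq_intros)
  qed

  \<comment> \<open>every function of class \<open>p\<close> with the same difference agrees with \<open>F (c x)\<close> up to a constant\<close>
  have unique: "\<exists>d. \<forall>x>0. phi F x = f x + d"
    if f: "f \<in> K_class (int p)" "\<And>x. x > 0 \<Longrightarrow> f (x + 1) - f x = gm x" for f
  proof -
    have "newton_null (Suc q) f"
      using newton_null_solution[OF f(1) gmD f(2)] assms by (auto intro: newton_null_mono)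
    thus ?thesis
      using newton_null_unique[OF null_F, of f] phi_eq[OF F_eq] f(2) by metis
  qed

  define psi where "psi = Sigma_op gm"
  have psiK: "psi \<in> K_signed (- s) p"
    unfolding psi_def by (rule Sigma_op_K_signed[OF gmD gmK g(3)])
  have "psi (x + 1) - psi x = gm x" if "x > 0" for x
    unfolding psi_def using that gmD gmK g(3)
    by (auto intro: Sigma_op_equation K_signed_imp_K_class)
  then obtain d where "\<And>x. x > 0 \<Longrightarrow> phi F x = psi x + d"
    using unique[of psi] K_signed_imp_K_class[OF psiK] g(3) by auto
  hence phiK: "phi F \<in> K_signed (- s) p" by (rule K_signed_cong_const[OF psiK])
  have "F = (\<lambda>x. phi F (1 / c * x + 0))" using c by (simp add: phi_def fun_eq_iff)
  thus FK: "F \<in> K_signed (- s) p"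
    using K_signed_affine[OF phiK, of "1 / c" 0] c by simp

  show "f x = F x"
    if f: "f \<in> K_class (int p)" "\<And>x. x > 0 \<Longrightarrow> (\<Sum>j<m. f (x + a * real j)) = h x" and x: "x > 0"
    for f x
  proof -
    obtain r where r: "\<bar>r\<bar> = 1" "f \<in> K_signed r p" using f(1) by (auto simp: K_class_iff)
    have "phi f \<in> K_class (int p)"
      using K_signed_affine[OF r(2) c, of 0] r by (auto simp: phi_def[abs_def] intro: K_signed_imp_K_class)
    then obtain d where d: "\<And>x. x > 0 \<Longrightarrow> phi F x = phi f x + d"
      using unique[of "phi f"] phi_eq[OF f(2)] by auto
    have F_f: "F y = f y + d" if "y > 0" for y
      using d[of "y / c"] c that by (simp add: phi_def)
    have "h x = (\<Sum>j<m. f (x + a * real j) + d)"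
      unfolding F_eq[OF x, symmetric] using x assms
      by (intro sum.cong refl F_f) (simp add: add_pos_nonneg)
    also have "\<dots> = h x + real m * d" using f(2)[OF x] by (simp add: sum.distrib)
    finally have "d = 0" using m by simp
    thus "f x = F x" using F_f[OF x] by simp
  qed
qed

theorem theorem8p71:
  fixes p q m :: nat and a :: real and h F :: "real \<Rightarrow> real"
  assumes "m \<ge> 1" and "a > 0" and "q \<ge> p"
    and "h \<in> D_class q \<inter> K_class (int q)"
  defines "F \<equiv> \<lambda>x. Sigma_op (dilate h (a * real m)) ((x + a) / (a * real m))
                   - Sigma_op (dilate h (a * real m)) (x / (a * real m))"
  shows "(fwd_diff (dilate h a) \<in> D_class p \<inter> K_plus (int p) \<inter> K_class (int q) \<longrightarrow>
            F \<in> K_class (int p) \<and>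
            (\<forall>x>0. (\<Sum>j<m. F (x + a * real j)) = h x) \<and>
            (\<forall>f. f \<in> K_class (int p) \<and> (\<forall>x>0. (\<Sum>j<m. f (x + a * real j)) = h x)
                 \<longrightarrow> (\<forall>x>0. f x = F x)) \<and>
            F \<in> K_minus (int p)) \<and>
         (fwd_diff (dilate h a) \<in> D_class p \<inter> K_minus (int p) \<inter> K_class (int q) \<longrightarrow>
            F \<in> K_class (int p) \<and>
            (\<forall>x>0. (\<Sum>j<m. F (x + a * real j)) = h x) \<and>
            (\<forall>f. f \<in> K_class (int p) \<and> (\<forall>x>0. (\<Sum>j<m. f (x + a * real j)) = h x)
                 \<longrightarrow> (\<forall>x>0. f x = F x)) \<and>
            F \<in> K_plus (int p))"
proof -
  have h: "h \<in> D_class q" "h \<in> K_class (int q)" using assms(4) by auto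
  have main: "F \<in> K_class (int p) \<and>
            (\<forall>x>0. (\<Sum>j<m. F (x + a * real j)) = h x) \<and>
            (\<forall>f. f \<in> K_class (int p) \<and> (\<forall>x>0. (\<Sum>j<m. f (x + a * real j)) = h x)
                 \<longrightarrow> (\<forall>x>0. f x = F x)) \<and>
            F \<in> K_signed (- s) p"
    if s: "\<bar>s\<bar> = 1" and g: "fwd_diff (dilate h a) \<in> D_class p" "fwd_diff (dilate h a) \<in> K_signed s p" for s
  proof -
    note * = sum_shift_eq_signed[OF assms(1-3) h g s meta_eq_to_obj_eq[OF F_def]]
    have "F \<in> K_class (int p)" using *(1) s by (auto intro: K_signed_imp_K_class)
    thus ?thesis using * by blast
  qed
  show ?thesis
    using main[of 1] main[of "-1"] by (simp add: K_plus_eq K_minus_eq)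
qed

end
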